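(* Let $\alpha=(\alpha_1,\dots,\alpha_n)$ be a nonzero vector, $\xi(x)=\sum_{i=1}^n\alpha_ix_i$ on $\mathbb{R}^n$, and let $\varphi>0$, $f>0$, $h$, $u$ be smooth functions on $\mathbb{R}^n$ depending only on $\xi$, with $u$ non-constant. Let $(F^m,g_F)$ be a semi-Riemannian manifold and suppose that $(\mathbb{R}^n\times_fF^m,g,h,u,\lambda)$, with $g=\varphi^{-2}g_0+f^2g_F$ and $h,u$ regarded as functions on the product through the projection to $\mathbb{R}^n$, is a GRHS; let $\mu$ be the constant with $Ric_{g_F}=\mu g_F$. If $\|\alpha\|^2=0$, then the GRHS is steady and $F^m$ is Ricci flat, that is, $\lambda=0$ and $\mu=0$.
   Context: $g_0$ is the semi-Euclidean metric on $\mathbb{R}^n$ with $(g_0)_{ij}=\epsilon_i\delta_{ij}$, $\epsilon_i=\pm1$, and $\|\alpha\|^2=\sum_i\epsilon_i\alpha_i^2$. For a semi-Riemannian manifold $(M,g)$, smooth $u,h:M\to\mathbb{R}$ and $\lambda\in\mathbb{R}$, $(M,g,h,u,\lambda)$ is a gradient Ricci-harmonic soliton (GRHS) if there is a constant $\theta\ge0$ with $$Ric_g+Hess\,h-\theta\,\nabla u\otimes\nabla u=\lambda g,\qquad \Delta_gu-g(\nabla u,\nabla h)=0,$$ where $(\nabla u\otimes\nabla u)(X,Y)=X(u)Y(u)$ and $\Delta_g=\mathrm{tr}_gHess$. It is steady if $\lambda=0$. For a GRHS of the form considered, $(F,g_F)$ is necessarily Einstein, $Ric_{g_F}=\mu g_F$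 with $\mu$ the constant $$\mu=f\Delta_{g_B}f+(m-1)|\nabla_{g_B}f|^2+\lambda f^2-f\,g_B(\nabla_{g_B}f,\nabla_{g_B}h),\qquad g_B=\varphi^{-2}g_0.$$ *)

theory Defs
  imports "HOL-Analysis.Analysis"
begin

section \<open>Smooth functions on open subsets of Euclidean space\<close>

definition partial :: "'n::finite \<Rightarrow> (real^'n \<Rightarrow> real) \<Rightarrow> real^'n \<Rightarrow> real" where
  "partial i s x = frechet_derivative s (at x) (axis i 1)"

text \<open>Only meaningful for open \<open>S\<close>, as \<^const>\<open>partial\<close> is taken with respect to the whole space.\<close>

primrec Ck_on :: "nat \<Rightarrow> (real^'n::finite \<Rightarrow> real) \<Rightarrow> (real^'n) set \<Rightarrow> bool" where
  "Ck_on 0 s S \<longleftrightarrow> continuous_on S s"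
| "Ck_on (Suc k) s S \<longleftrightarrow> s differentiable_on S \<and> (\<forall>i. Ck_on k (partial i s) S)"

definition smooth_on :: "(real^'n::finite \<Rightarrow> real) \<Rightarrow> (real^'n) set \<Rightarrow> bool" where
  "smooth_on s S \<longleftrightarrow> (\<forall>k. Ck_on k s S)"

section \<open>Smooth manifolds\<close>

text \<open>
  An atlas is an indexed family of charts (coordinate domain, coordinate map); the manifold is
  the whole type \<open>'a\<close>, which is therefore nonempty. The sorts supply the Hausdorff
  property and second countability. The atlas need not be maximal: it determines the
  smooth structure.
\<close>

type_synonym ('c, 'a, 'm) atlas = "'c \<Rightarrow> 'a set \<times> ('a \<Rightarrow> real^'m)"

abbreviation chart_dom :: "('c, 'a, 'm::finite) atlas \<Rightarrow> 'c \<Rightarrow> 'a set" where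
  "chart_dom A c \<equiv> fst (A c)"

abbreviation chart_map :: "('c, 'a, 'm::finite) atlas \<Rightarrow> 'c \<Rightarrow> 'a \<Rightarrow> real^'m" where
  "chart_map A c \<equiv> snd (A c)"

definition chart_image :: "('c, 'a, 'm::finite) atlas \<Rightarrow> 'c \<Rightarrow> (real^'m) set" where
  "chart_image A c = chart_map A c ` chart_dom A c"

definition chart_inv :: "('c, 'a, 'm::finite) atlas \<Rightarrow> 'c \<Rightarrow> real^'m \<Rightarrow> 'a" where
  "chart_inv A c = inv_into (chart_dom A c) (chart_map A c)"

definition smooth_manifold ::
  "('c, 'a::{t2_space,second_countable_topology}, 'm::finite) atlas \<Rightarrow> bool" where
  "smooth_manifold A \<longleftrightarrow>
     (\<Union>c. chart_dom A c) = UNIV \<and>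
     (\<forall>c. open (chart_dom A c) \<and> open (chart_image A c) \<and>
        homeomorphism (chart_dom A c) (chart_image A c) (chart_map A c) (chart_inv A c)) \<and>
     (\<forall>c d k. smooth_on (\<lambda>y. chart_map A d (chart_inv A c y) $ k)
        (chart_map A c ` (chart_dom A c \<inter> chart_dom A d)))"

definition smooth_fun :: "('c, 'a, 'm::finite) atlas \<Rightarrow> ('a \<Rightarrow> real) \<Rightarrow> bool" where
  "smooth_fun A s \<longleftrightarrow> (\<forall>c. smooth_on (s \<circ> chart_inv A c) (chart_image A c))"

section \<open>Semi-Riemannian metrics\<close>

text \<open>
  A (0,2)-tensor field is given by its components: \<open>T c p $ i $ j\<close> is the value of the
  tensor at \<open>p\<close> on the \<open>i\<close>-th and \<open>j\<close>-th coordinate vectors of the chart \<open>c\<close>. Values at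
  points outside the domain of \<open>c\<close> are irrelevant.
\<close>

type_synonym ('c, 'a, 'm) tensor2 = "'c \<Rightarrow> 'a \<Rightarrow> real^'m^'m"

text \<open>The index of a symmetric bilinear form: the largest dimension of a subspace on which the
  form is negative definite.\<close>

definition form_index :: "real^'m^'m::finite \<Rightarrow> nat" where
  "form_index B =
     Max {dim W | W. subspace W \<and> (\<forall>w\<in>W. w \<noteq> 0 \<longrightarrow> w \<bullet> (B *v w) < 0)}"

definition semi_riemannian ::
  "('c, 'a::{t2_space,second_countable_topology}, 'm::finite) atlas \<Rightarrow>
   ('c, 'a, 'm) tensor2 \<Rightarrow> bool" where
  "semi_riemannian A g \<longleftrightarrow>
     smooth_manifold A \<and>
     (\<forall>c i j. smooth_on (\<lambda>y. g c (chart_inv A c y) $ i $ j) (chart_image A c)) \<and>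
     (\<forall>c d. \<forall>p \<in> chart_dom A c \<inter> chart_dom A d.
        let J = jacobian (chart_map A d \<circ> chart_inv A c) (at (chart_map A c p))
        in g c p = transpose J ** g d p ** J) \<and>
     (\<forall>c. \<forall>p \<in> chart_dom A c. transpose (g c p) = g c p \<and> invertible (g c p)) \<and>
     (\<exists>\<nu>. \<forall>c. \<forall>p \<in> chart_dom A c. form_index (g c p) = \<nu>)"

section \<open>Curvature and differential operators in coordinates\<close>

text \<open>Here \<open>G\<close> is the component matrix of a metric as a function of the coordinates.\<close>

definition christoffel ::
  "(real^'m \<Rightarrow> real^'m^'m) \<Rightarrow> 'm::finite \<Rightarrow> 'm \<Rightarrow> 'm \<Rightarrow> real^'m \<Rightarrow> real" where
  "christoffel G k i j y =
     (\<Sum>l\<in>UNIV. matrix_inv (G y) $ k $ l *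
        (partial i (\<lambda>z. G z $ j $ l) y + partial j (\<lambda>z. G z $ i $ l) y
         - partial l (\<lambda>z. G z $ i $ j) y)) / 2"

text \<open>\<open>curvature G l k i j\<close> is the coefficient of \<open>\<partial>\<^sub>l\<close> in \<open>R(\<partial>\<^sub>i, \<partial>\<^sub>j)\<partial>\<^sub>k\<close>, where
  \<open>R(X, Y)Z = \<nabla>\<^sub>X\<nabla>\<^sub>YZ - \<nabla>\<^sub>Y\<nabla>\<^sub>XZ - \<nabla>\<^bsub>[X, Y]\<^esub>Z\<close>; and \<open>Ric(Y, Z)\<close> is the trace of \<open>X \<mapsto> R(X, Y)Z\<close>,
  so that round spheres have positive Ricci curvature.\<close>

definition curvature ::
  "(real^'m \<Rightarrow> real^'m^'m) \<Rightarrow> 'm::finite \<Rightarrow> 'm \<Rightarrow> 'm \<Rightarrow> 'm \<Rightarrow> real^'m \<Rightarrow> real" where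
  "curvature G l k i j y =
     partial i (christoffel G l j k) y - partial j (christoffel G l i k) y
     + (\<Sum>r\<in>UNIV. christoffel G l i r y * christoffel G r j k y
                 - christoffel G l j r y * christoffel G r i k y)"

definition ricci :: "(real^'m \<Rightarrow> real^'m^'m) \<Rightarrow> real^'m \<Rightarrow> real^'m^'m::finite" where
  "ricci G y = (\<chi> j k. \<Sum>i\<in>UNIV. curvature G i k i j y)"

definition hessian ::
  "(real^'m \<Rightarrow> real^'m^'m) \<Rightarrow> (real^'m \<Rightarrow> real) \<Rightarrow> real^'m \<Rightarrow> real^'m^'m::finite" where
  "hessian G s y =
     (\<chi> i j. partial i (partial j s) y - (\<Sum>k\<in>UNIV. christoffel G k i j y * partial k s y))"

definition laplacian ::
  "(real^'m \<Rightarrow> real^'m^'m) \<Rightarrow> (real^'m \<Rightarrow> real) \<Rightarrow> real^'m::finite \<Rightarrow> real" where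
  "laplacian G s y = (\<Sum>i\<in>UNIV. \<Sum>j\<in>UNIV. matrix_inv (G y) $ i $ j * hessian G s y $ i $ j)"

definition differential :: "(real^'m \<Rightarrow> real) \<Rightarrow> real^'m \<Rightarrow> real^'m::finite" where
  "differential s y = (\<chi> i. partial i s y)"

definition gradient ::
  "(real^'m \<Rightarrow> real^'m^'m) \<Rightarrow> (real^'m \<Rightarrow> real) \<Rightarrow> real^'m \<Rightarrow> real^'m::finite" where
  "gradient G s y = matrix_inv (G y) *v differential s y"

section \<open>The same objects on a semi-Riemannian manifold\<close>

definition ricci_tensor ::
  "('c, 'a, 'm::finite) atlas \<Rightarrow> ('c, 'a, 'm) tensor2 \<Rightarrow> ('c, 'a, 'm) tensor2" where
  "ricci_tensor A g c p = ricci (g c \<circ> chart_inv A c) (chart_map A c p)"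

definition hessian_tensor ::
  "('c, 'a, 'm::finite) atlas \<Rightarrow> ('c, 'a, 'm) tensor2 \<Rightarrow> ('a \<Rightarrow> real) \<Rightarrow> ('c, 'a, 'm) tensor2" where
  "hessian_tensor A g s c p =
     hessian (g c \<circ> chart_inv A c) (s \<circ> chart_inv A c) (chart_map A c p)"

text \<open>\<open>\<nabla>s \<otimes> \<nabla>s\<close>, that is, \<open>(X, Y) \<mapsto> X(s) Y(s)\<close>.\<close>

definition grad_tensor_grad ::
  "('c, 'a, 'm::finite) atlas \<Rightarrow> ('a \<Rightarrow> real) \<Rightarrow> ('c, 'a, 'm) tensor2" where
  "grad_tensor_grad A s c p =
     (\<chi> i j. partial i (s \<circ> chart_inv A c) (chart_map A c p)
            * partial j (s \<circ> chart_inv A c) (chart_map A c p))"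

definition laplace_beltrami ::
  "('c, 'a, 'm::finite) atlas \<Rightarrow> ('c, 'a, 'm) tensor2 \<Rightarrow> ('a \<Rightarrow> real) \<Rightarrow> 'c \<Rightarrow> 'a \<Rightarrow> real" where
  "laplace_beltrami A g s c p =
     laplacian (g c \<circ> chart_inv A c) (s \<circ> chart_inv A c) (chart_map A c p)"

definition grad ::
  "('c, 'a, 'm::finite) atlas \<Rightarrow> ('c, 'a, 'm) tensor2 \<Rightarrow> ('a \<Rightarrow> real) \<Rightarrow> 'c \<Rightarrow> 'a \<Rightarrow> real^'m" where
  "grad A g s c p = gradient (g c \<circ> chart_inv A c) (s \<circ> chart_inv A c) (chart_map A c p)"

definition metric_apply ::
  "('c, 'a, 'm::finite) tensor2 \<Rightarrow> 'c \<Rightarrow> 'a \<Rightarrow> real^'m \<Rightarrow> real^'m \<Rightarrow> real" where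
  "metric_apply g c p v w = v \<bullet> (g c p *v w)"

definition einstein_with ::
  "('c, 'a, 'm::finite) atlas \<Rightarrow> ('c, 'a, 'm) tensor2 \<Rightarrow> real \<Rightarrow> bool" where
  "einstein_with A g \<mu> \<longleftrightarrow> (\<forall>c. \<forall>p \<in> chart_dom A c. ricci_tensor A g c p = \<mu> *\<^sub>R g c p)"

definition ricci_flat ::
  "('c, 'a, 'm::finite) atlas \<Rightarrow> ('c, 'a, 'm) tensor2 \<Rightarrow> bool" where
  "ricci_flat A g \<longleftrightarrow> (\<forall>c. \<forall>p \<in> chart_dom A c. ricci_tensor A g c p = 0)"

definition grhs ::
  "('c, 'a::{t2_space,second_countable_topology}, 'm::finite) atlas \<Rightarrow> ('c, 'a, 'm) tensor2 \<Rightarrow>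
   ('a \<Rightarrow> real) \<Rightarrow> ('a \<Rightarrow> real) \<Rightarrow> real \<Rightarrow> bool" where
  "grhs A g h u lam \<longleftrightarrow>
     semi_riemannian A g \<and> smooth_fun A h \<and> smooth_fun A u \<and>
     (\<exists>\<theta>\<ge>0. \<forall>c. \<forall>p \<in> chart_dom A c.
        ricci_tensor A g c p + hessian_tensor A g h c p - \<theta> *\<^sub>R grad_tensor_grad A u c p
          = lam *\<^sub>R g c p \<and>
        laplace_beltrami A g u c p - metric_apply g c p (grad A g u c p) (grad A g h c p) = 0)"

section \<open>Euclidean space, products and warped products\<close>

definition euclidean_atlas :: "(unit, real^'n, 'n::finite) atlas" where
  "euclidean_atlas = (\<lambda>_. (UNIV, \<lambda>x. x))"

definition join :: "real^'n \<Rightarrow> real^'m \<Rightarrow> real^('n::finite + 'm::finite)" where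
  "join v w = (\<chi> k. case k of Inl i \<Rightarrow> v $ i | Inr j \<Rightarrow> w $ j)"

definition prod_atlas ::
  "('c, 'a, 'n::finite) atlas \<Rightarrow> ('d, 'b, 'm::finite) atlas \<Rightarrow> ('c \<times> 'd, 'a \<times> 'b, 'n + 'm) atlas"
  where
  "prod_atlas A B =
     (\<lambda>(c, d). (chart_dom A c \<times> chart_dom B d,
                \<lambda>(p, q). join (chart_map A c p) (chart_map B d q)))"

text \<open>\<open>g\<^sub>B + s\<^sup>2 g\<^sub>F\<close> on the product, in block form.\<close>

definition warped_metric ::
  "('c, 'a, 'n::finite) tensor2 \<Rightarrow> ('a \<Rightarrow> real) \<Rightarrow> ('d, 'b, 'm::finite) tensor2 \<Rightarrow>
   ('c \<times> 'd, 'a \<times> 'b, 'n + 'm) tensor2" where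
  "warped_metric gB s gF =
     (\<lambda>(c, d) (p, q). \<chi> k l. case (k, l) of
          (Inl i, Inl j) \<Rightarrow> gB c p $ i $ j
        | (Inr i, Inr j) \<Rightarrow> (s p)\<^sup>2 * gF d q $ i $ j
        | _ \<Rightarrow> 0)"

definition semi_euclidean :: "('n::finite \<Rightarrow> real) \<Rightarrow> real^'n^'n" where
  "semi_euclidean \<epsilon> = (\<chi> i j. if i = j then \<epsilon> i else 0)"

definition conformal_metric ::
  "('n::finite \<Rightarrow> real) \<Rightarrow> (real^'n \<Rightarrow> real) \<Rightarrow> (unit, real^'n, 'n) tensor2" where
  "conformal_metric \<epsilon> \<phi> = (\<lambda>_ x. (1 / (\<phi> x)\<^sup>2) *\<^sub>R semi_euclidean \<epsilon>)"

definition semi_norm_sq :: "('n::finite \<Rightarrow> real) \<Rightarrow> real^'n \<Rightarrow> real" where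
  "semi_norm_sq \<epsilon> \<alpha> = (\<Sum>i\<in>UNIV. \<epsilon> i * (\<alpha> $ i)\<^sup>2)"

text \<open>\<open>s\<close> is a function of \<open>\<xi>(x) = \<Sum>\<^sub>i \<alpha>\<^sub>i x\<^sub>i\<close> only.\<close>

definition depends_only_on_xi :: "real^'n::finite \<Rightarrow> (real^'n \<Rightarrow> real) \<Rightarrow> bool" where
  "depends_only_on_xi \<alpha> s \<longleftrightarrow> (\<exists>r. \<forall>x. s x = r (\<Sum>i\<in>UNIV. \<alpha> $ i * x $ i))"

end

theory Submission
  imports Defs
begin

text \<open>Along a null direction \<open>\<alpha>\<close> all scalar quantities \<open>g(\<nabla>a, \<nabla>b)\<close> and \<open>\<Delta>a\<close> formed from functions \<open>a, b\<close>
  of \<open>\<xi>\<close> carry the factor \<open>\<parallel>\<alpha>\<parallel>\<^sup>2\<close> and vanish. The soliton equation on the warped product then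
  decouples as follows.

  On the base, the Ricci tensor of the warped product (\<open>ricci_G_base\<close>), the Hessian of \<open>h\<close> (\<open>hessian_G\<close>)
  and \<open>\<nabla>u \<otimes> \<nabla>u\<close> are all multiples of \<open>\<alpha>\<^sub>i \<alpha>\<^sub>j\<close>, so the equation reads
  \<open>w \<alpha>\<^sub>i \<alpha>\<^sub>j = \<lambda> \<epsilon>\<^sub>i \<delta>\<^sub>i\<^sub>j / \<phi>\<^sup>2\<close> for some number \<open>w\<close>. Multiplying by \<open>\<epsilon>\<^sub>j \<alpha>\<^sub>j\<close> and summing over \<open>j\<close>
  gives \<open>0 = \<lambda> \<alpha>\<^sub>i / \<phi>\<^sup>2\<close>, hence \<open>\<lambda> = 0\<close>, because \<open>\<alpha> \<noteq> 0\<close>.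

  On the fibre, the Ricci tensor of the warped product is that of \<open>F\<close> (\<open>ricci_G_fibre\<close>), and the other
  two terms vanish, so \<open>Ric\<^sub>F = \<lambda> f\<^sup>2 g\<^sub>F = 0\<close>. A nondegenerate Ricci-flat metric is Einstein only
  with constant \<open>0\<close>.

  The curvature formulas come from computing the Christoffel symbols in a product chart
  (\<open>christoffel_G\<close>) and their derivatives (\<open>partial_christoffel_G\<close>).\<close>

section \<open>Partial derivatives and locality\<close>

lemma partial_eqI:
  assumes "(s has_derivative D) (at x)"
  shows "partial i s x = D (axis i 1)"
  using frechet_derivative_at[OF assms] by (simp add: partial_def)

lemma partial_const [simp]: "partial i (\<lambda>_. c) x = 0"
  by (rule partial_eqI[where D="\<lambda>_. 0", simplified]) simp

lemma partial_cong_open: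
  assumes "open S" "x \<in> S" "\<And>y. y \<in> S \<Longrightarrow> s y = t y"
  shows "partial i s x = partial i t x"
proof -
  have "(s has_derivative D) (at x) \<longleftrightarrow> (t has_derivative D) (at x)" for D
    using assms has_derivative_transform_within_open[of s D x UNIV S t]
      has_derivative_transform_within_open[of t D x UNIV S s] by auto
  then show ?thesis by (simp add: partial_def frechet_derivative_def)
qed

text \<open>Curvature and Hessian at a point depend only on the germs of the metric and of the function
  there. A metric in a chart, which is composed with an inverse that is arbitrary outside the
  chart image, may therefore be replaced by an explicit formula valid on the chart image.\<close>

lemma christoffel_cong_open:
  assumes "open S" "x \<in> S" "\<And>y. y \<in> S \<Longrightarrow> G y = G' y"
  shows "christoffel G k i j x = christoffel G' k i j x"
proof -
  have "partial a (\<lambda>z. G z $ b $ c) x = partial a (\<lambda>z. G' z $ b $ c) x" for a b c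
    by (rule partial_cong_open[OF assms(1,2)]) (simp add: assms(3))
  then show ?thesis by (simp add: christoffel_def assms(2,3))
qed

lemma ricci_cong_open:
  assumes "open S" "x \<in> S" "\<And>y. y \<in> S \<Longrightarrow> G y = G' y"
  shows "ricci G x = ricci G' x"
proof -
  have *: "christoffel G k i j y = christoffel G' k i j y" if "y \<in> S" for k i j y
    by (rule christoffel_cong_open[OF assms(1) that assms(3)])
  have "partial a (christoffel G k i j) x = partial a (christoffel G' k i j) x" for a k i j
    by (rule partial_cong_open[OF assms(1,2)]) (rule *)
  then show ?thesis by (simp add: ricci_def curvature_def * assms(2))
qed

lemma hessian_cong_open:
  assumes "open S" "x \<in> S" "\<And>y. y \<in> S \<Longrightarrow> G y = G' y" "\<And>y. y \<in> S \<Longrightarrow> s y = s' y"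
  shows "hessian G s x = hessian G' s' x"
proof -
  have *: "partial i s y = partial i s' y" if "y \<in> S" for i y
    by (rule partial_cong_open[OF assms(1) that assms(4)])
  have "partial i (partial j s) x = partial i (partial j s') x" for i j
    by (rule partial_cong_open[OF assms(1,2)]) (rule *)
  then show ?thesis
    by (simp add: hessian_def * assms(2) christoffel_cong_open[OF assms(1,2,3)])
qed

section \<open>Differentiability of the Christoffel symbols\<close>

lemma differentiable_det:
  fixes A :: "real^'n \<Rightarrow> real^'m^'m"
  assumes "\<And>i j. (\<lambda>y. A y $ i $ j) differentiable at x"
  shows "(\<lambda>y. det (A y)) differentiable at x"
proof -
  have "(\<lambda>y. \<Prod>i\<in>UNIV. A y $ i $ \<sigma> i) differentiable at x" for \<sigma> :: "'m \<Rightarrow> 'm"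
  proof -
    have "((\<lambda>y. A y $ i $ \<sigma> i) has_derivative
        frechet_derivative (\<lambda>y. A y $ i $ \<sigma> i) (at x)) (at x)" for i
      by (rule iffD1[OF frechet_derivative_works assms])
    from has_derivative_prod[OF this] show ?thesis
      by (rule differentiableI)
  qed
  then show ?thesis
    unfolding det_def by (simp add: finite_permutations)
qed

lemma matrix_inv_right:
  fixes A :: "real^'n^'n"
  assumes "invertible A"
  shows "A ** matrix_inv A = mat 1"
  using assms unfolding invertible_def matrix_inv_def by (rule someI2_ex) auto

lemma matrix_inv_eqI:
  fixes A B :: "real^'n^'n"
  assumes "A ** B = mat 1"
  shows "matrix_inv A = B"
proof -
  have BA: "B ** A = mat 1" using assms by (simp add: matrix_left_right_inverse)
  with assms have "A ** matrix_inv A = mat 1"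
    by (intro matrix_inv_right) (auto simp: invertible_def)
  then have "B ** (A ** matrix_inv A) = B" by simp
  then show ?thesis by (simp add: matrix_mul_assoc BA)
qed

text \<open>Cramer's rule expresses the entries of the inverse as quotients of determinants.\<close>

lemma differentiable_matrix_inv:
  fixes A :: "real^'n \<Rightarrow> real^'m^'m"
  assumes "open S" "x \<in> S" "\<And>y. y \<in> S \<Longrightarrow> invertible (A y)"
    and A: "\<And>i j. (\<lambda>y. A y $ i $ j) differentiable at x"
  shows "(\<lambda>y. matrix_inv (A y) $ k $ l) differentiable at x"
proof -
  let ?C = "\<lambda>y. (\<chi> i j. if j = k then axis l 1 $ i else A y $ i $ j) :: real^'m^'m"
  have eq: "det (?C y) / det (A y) = matrix_inv (A y) $ k $ l" if "y \<in> S" for y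
  proof -
    have inv: "invertible (A y)" using assms(3) that .
    have "A y *v (matrix_inv (A y) *v axis l 1) = axis l 1"
      by (simp add: matrix_vector_mul_assoc matrix_inv_right[OF inv])
    moreover have "det (A y) \<noteq> 0" using inv by (simp add: invertible_det_nz)
    ultimately have "matrix_inv (A y) *v axis l 1 =
        (\<chi> k. det (\<chi> i j. if j = k then axis l 1 $ i else A y $ i $ j) / det (A y))"
      by (simp add: cramer)
    then have "(matrix_inv (A y) *v axis l 1) $ k = det (?C y) / det (A y)" by simp
    then show ?thesis by (simp add: matrix_vector_mult_basis column_def)
  qed
  have "(\<lambda>y. det (?C y) / det (A y)) differentiable at x"
  proof (rule differentiable_divide)
    show "(\<lambda>y. det (?C y)) differentiable at x"
    proof (rule differentiable_det)
      fix i j show "(\<lambda>y. ?C y $ i $ j) differentiable at x"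
        by (cases "j = k") (simp_all add: A)
    qed
    show "(\<lambda>y. det (A y)) differentiable at x" by (rule differentiable_det[OF A])
    show "det (A x) \<noteq> 0" using assms(2,3) by (simp add: invertible_det_nz)
  qed
  then obtain D where D: "((\<lambda>y. det (?C y) / det (A y)) has_derivative D) (at x)"
    unfolding differentiable_def by blast
  have "((\<lambda>y. matrix_inv (A y) $ k $ l) has_derivative D) (at x)"
    by (rule has_derivative_transform_within_open[OF D assms(1,2) eq])
  then show ?thesis by (rule differentiableI)
qed

lemma smooth_onD:
  assumes "smooth_on s S" "open S" "x \<in> S"
  shows "s differentiable at x" and "partial i s differentiable at x"
proof -
  have "Ck_on (Suc (Suc 0)) s S" using assms(1) by (simp only: smooth_on_def)
  then have "s differentiable_on S" "partial i s differentiable_on S" by auto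
  then show "s differentiable at x" "partial i s differentiable at x"
    using assms(2,3) by (simp_all add: differentiable_on_eq_differentiable_at)
qed

lemma christoffel_differentiable:
  fixes P :: "real^'m \<Rightarrow> real^'m^'m"
  assumes "open S" "x \<in> S" "\<And>y. y \<in> S \<Longrightarrow> invertible (P y)"
    and "\<And>i j. smooth_on (\<lambda>y. P y $ i $ j) S"
  shows "christoffel P k i j differentiable at x"
proof -
  have "(\<lambda>y. matrix_inv (P y) $ k $ l) differentiable at x" for l
    by (rule differentiable_matrix_inv[OF assms(1-3)]) (auto intro: smooth_onD[OF assms(4,1,2)])
  then show ?thesis
    unfolding christoffel_def[abs_def]
    by (intro differentiable_divide differentiable_sum differentiable_mult differentiable_add
        differentiable_diff differentiable_const smooth_onD(2)[OF assms(4,1,2)] ballI) simp_all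
qed

section \<open>Functions of one linear form\<close>

text \<open>Restriction to the line through \<open>a\<close>, where \<open>\<alpha> \<bullet> a = 1\<close>, recovers the profile \<open>r\<close> from \<open>s\<close>, so
  \<open>r\<close> is differentiable. The partial derivatives of \<open>s\<close> are again functions of \<open>\<alpha> \<bullet> x\<close>.\<close>

lemma ridge_derivative:
  fixes \<alpha> :: "real^'n" and s :: "real^'n \<Rightarrow> real"
  assumes "\<alpha> \<noteq> 0" "\<And>x. s x = r (\<alpha> \<bullet> x)" "\<And>x. s differentiable at x"
  shows "\<exists>r'. (\<forall>t. (r has_real_derivative r' t) (at t)) \<and>
    (\<forall>i x. partial i s x = r' (\<alpha> \<bullet> x) * \<alpha> $ i)"
proof -
  define a where "a = \<alpha> /\<^sub>R (\<alpha> \<bullet> \<alpha>)"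
  have a: "\<alpha> \<bullet> (t *\<^sub>R a) = t" for t using assms(1) by (simp add: a_def)
  define r' where "r' t = frechet_derivative s (at (t *\<^sub>R a)) a" for t
  have r: "(r has_real_derivative r' t) (at t)" for t
  proof -
    define D where "D = frechet_derivative s (at (t *\<^sub>R a))"
    have D: "(s has_derivative D) (at (t *\<^sub>R a))"
      using assms(3) frechet_derivative_works unfolding D_def by blast
    interpret D: bounded_linear D using D by (rule has_derivative_bounded_linear)
    have "((\<lambda>t. s (t *\<^sub>R a)) has_derivative (\<lambda>h. D (h *\<^sub>R a))) (at t)"
      by (rule has_derivative_compose[where f="\<lambda>t. t *\<^sub>R a", OF _ D])
         (auto intro!: derivative_eq_intros)
    moreover have "(\<lambda>t. s (t *\<^sub>R a)) = r" by (simp only: assms(2) a)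
    ultimately show ?thesis
      by (simp add: has_field_derivative_def D.scaleR r'_def D_def[symmetric]
          mult.commute[of _ "D a"])
  qed
  have "partial i s x = r' (\<alpha> \<bullet> x) * \<alpha> $ i" for i x
  proof -
    have "((\<lambda>x. r (\<alpha> \<bullet> x)) has_derivative (\<lambda>v. r' (\<alpha> \<bullet> x) * (\<alpha> \<bullet> v))) (at x)"
      by (rule has_derivative_compose[where f="\<lambda>x. \<alpha> \<bullet> x",
            OF _ r[of "\<alpha> \<bullet> x", unfolded has_field_derivative_def]])
         (auto intro!: derivative_eq_intros)
    moreover have "s = (\<lambda>x. r (\<alpha> \<bullet> x))" using assms(2) by auto
    ultimately show ?thesis by (simp add: partial_eqI inner_axis)
  qed
  with r show ?thesis by blast
qed

lemma smooth_profile: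
  fixes \<alpha> :: "real^'n" and s :: "real^'n \<Rightarrow> real"
  assumes "\<alpha> \<noteq> 0" "smooth_on s UNIV" "depends_only_on_xi \<alpha> s"
  shows "\<exists>r r' r''. (\<forall>x. s x = r (\<alpha> \<bullet> x)) \<and> (\<forall>t. (r has_real_derivative r' t) (at t)) \<and>
    (\<forall>t. (r' has_real_derivative r'' t) (at t))"
proof -
  obtain r where r: "\<And>x. s x = r (\<alpha> \<bullet> x)"
    using assms(3) by (auto simp: depends_only_on_xi_def inner_vec_def)
  obtain r' where r': "\<And>t. (r has_real_derivative r' t) (at t)"
    "\<And>i x. partial i s x = r' (\<alpha> \<bullet> x) * \<alpha> $ i"
    using ridge_derivative[OF assms(1) r smooth_onD(1)[OF assms(2)]] by auto
  obtain i where i: "\<alpha> $ i \<noteq> 0" using assms(1) by (auto simp: vec_eq_iff)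
  \<comment> \<open>The derivative of the profile is itself the profile of a differentiable function.\<close>
  have e: "\<And>x. partial i s x / \<alpha> $ i = r' (\<alpha> \<bullet> x)" using i r'(2) by simp
  have d: "(\<lambda>x. partial i s x / \<alpha> $ i) differentiable at x" for x
    using i by (intro differentiable_divide smooth_onD(2)[OF assms(2)]) auto
  obtain r'' where "\<And>t. (r' has_real_derivative r'' t) (at t)"
    using ridge_derivative[OF assms(1) e d] by blast
  with r r'(1) show ?thesis by blast
qed

section \<open>Coordinates on a product\<close>

lemma sum_UNIV_Plus:
  fixes g :: "'n::finite + 'm::finite \<Rightarrow> 'a::comm_monoid_add"
  shows "(\<Sum>k\<in>UNIV. g k) = (\<Sum>i\<in>UNIV. g (Inl i)) + (\<Sum>a\<in>UNIV. g (Inr a))"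
proof -
  have "(\<Sum>k\<in>UNIV. g k) = (\<Sum>k\<in>range Inl \<union> range Inr. g k)"
    by (simp only: UNIV_sum)
  also have "\<dots> = (\<Sum>k\<in>range Inl. g k) + (\<Sum>k\<in>range Inr. g k)"
    by (rule sum.union_disjoint) auto
  finally show ?thesis by (simp add: sum.reindex)
qed

lemma sum_if_delta [simp]:
  fixes g :: "'n::finite \<Rightarrow> real"
  shows "(\<Sum>l\<in>UNIV. (if k = l then c else 0) * g l) = c * g k"
    "(\<Sum>l\<in>UNIV. (if l = k then c else 0) * g l) = c * g k"
  by (simp_all add: if_distrib[of "\<lambda>x. x * _"] cong: if_cong)

text \<open>The two components of a coordinate vector on the product, inverse to \<^const>\<open>join\<close>.\<close>

definition base_part :: "real^('n::finite + 'm::finite) \<Rightarrow> real^'n" where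
  "base_part z = (\<chi> i. z $ Inl i)"

definition fibre_part :: "real^('n::finite + 'm::finite) \<Rightarrow> real^'m" where
  "fibre_part z = (\<chi> a. z $ Inr a)"

lemma base_part_join [simp]: "base_part (join v w) = v"
  by (simp add: base_part_def join_def vec_eq_iff)

lemma fibre_part_join [simp]: "fibre_part (join v w) = w"
  by (simp add: fibre_part_def join_def vec_eq_iff)

lemma join_parts [simp]: "join (base_part z) (fibre_part z) = z"
  by (simp add: fibre_part_def base_part_def join_def vec_eq_iff split: sum.split)

lemma bounded_linear_base_part: "bounded_linear base_part"
  by (rule linear_conv_bounded_linear[THEN iffD1], rule linearI)
     (simp_all add: base_part_def vec_eq_iff)

lemma bounded_linear_fibre_part: "bounded_linear fibre_part"
  by (rule linear_conv_bounded_linear[THEN iffD1], rule linearI)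
     (simp_all add: fibre_part_def vec_eq_iff)

lemma base_part_axis [simp]:
  "base_part (axis (Inl i) c) = axis i c" "base_part (axis (Inr a) c) = 0"
  by (simp_all add: base_part_def axis_def vec_eq_iff)

lemma fibre_part_axis [simp]:
  "fibre_part (axis (Inl i) c) = 0" "fibre_part (axis (Inr a) c) = axis a c"
  by (simp_all add: fibre_part_def axis_def vec_eq_iff)

lemma open_fibre_vimage:
  assumes "open V"
  shows "open {z. fibre_part z \<in> V}"
  using open_vimage[OF assms linear_continuous_on[OF bounded_linear_fibre_part]]
  by (simp add: vimage_def)

section \<open>Warped products over a conformal null-ridge metric\<close>

text \<open>The coordinate picture of the warped product: the base is \<open>\<real>\<^sup>n\<close> with the metric
  \<open>\<phi>(\<xi>)\<^sup>-\<^sup>2 g\<^sub>0\<close>, where \<open>\<xi> = \<alpha> \<bullet> x\<close> and \<open>\<alpha>\<close> is null for \<open>g\<^sub>0\<close>; the warping function is \<open>f(\<xi>)\<close>;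
  the fibre is an open set \<open>V\<close> of coordinates with metric components \<open>P\<close>. Here \<open>\<phi>\<close> and \<open>f\<close> are
  functions of one real variable, given with their first two derivatives.\<close>

locale null_warped_product =
  fixes \<epsilon> :: "'n::finite \<Rightarrow> real" and \<alpha> :: "real^'n"
    and \<phi> \<phi>' \<phi>'' f f' f'' :: "real \<Rightarrow> real"
    and P :: "real^'m::finite \<Rightarrow> real^'m^'m" and V :: "(real^'m) set"
  assumes eps_sq: "\<And>i. \<epsilon> i * \<epsilon> i = 1"
    and null: "(\<Sum>i\<in>UNIV. \<epsilon> i * (\<alpha> $ i)\<^sup>2) = 0"
    and pos: "\<And>t. \<phi> t > 0" "\<And>t. f t > 0"
    and deriv: "\<And>t. (\<phi> has_real_derivative \<phi>' t) (at t)"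
      "\<And>t. (\<phi>' has_real_derivative \<phi>'' t) (at t)"
      "\<And>t. (f has_real_derivative f' t) (at t)"
      "\<And>t. (f' has_real_derivative f'' t) (at t)"
    and V: "open V"
    and P: "\<And>y. y \<in> V \<Longrightarrow> transpose (P y) = P y" "\<And>y. y \<in> V \<Longrightarrow> invertible (P y)"
      "\<And>a b. smooth_on (\<lambda>y. P y $ a $ b) V"
begin

text \<open>The linear form \<open>\<xi>\<close>, read on the product.\<close>

definition xi :: "real^('n + 'm) \<Rightarrow> real" where "xi z = \<alpha> \<bullet> base_part z"

text \<open>The component matrix of the warped metric. It is given by the same formula for all \<open>z\<close>, but
  is a metric only over \<open>V\<close>, that is, on the set \<open>S\<close> below.\<close>

definition G :: "real^('n + 'm) \<Rightarrow> real^('n + 'm)^('n + 'm)" where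
  "G z = warped_metric (conformal_metric \<epsilon> (\<lambda>x. \<phi> (\<alpha> \<bullet> x))) (\<lambda>x. f (\<alpha> \<bullet> x)) (\<lambda>_. P)
           ((), ()) (base_part z, fibre_part z)"

abbreviation S :: "(real^('n + 'm)) set" where "S \<equiv> {z. fibre_part z \<in> V}"

lemma open_S: "open S"
  by (rule open_fibre_vimage[OF V])

lemma null_sum0: "(\<Sum>i\<in>UNIV. \<epsilon> i * (\<alpha> $ i * \<alpha> $ i)) = 0"
  using null by (simp add: power2_eq_square)

lemma null_sum [simp]:
  "(\<Sum>i\<in>UNIV. c * (\<epsilon> i * (\<alpha> $ i * \<alpha> $ i))) = 0"
  by (simp add: sum_distrib_left[symmetric] null_sum0)

text \<open>Every function that has to be differentiated below (metric components, Christoffel symbols) is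
  a product of a function of \<open>\<xi>\<close> and a function of the fibre coordinates.\<close>

lemma partial_separated:
  assumes F: "(F has_real_derivative D) (at (xi z))" and Q: "Q differentiable at (fibre_part z)"
  shows "partial (Inl i) (\<lambda>z. F (xi z) * Q (fibre_part z)) z = D * \<alpha> $ i * Q (fibre_part z)"
    and "partial (Inr a) (\<lambda>z. F (xi z) * Q (fibre_part z)) z
           = F (xi z) * partial a Q (fibre_part z)"
proof -
  let ?E = "frechet_derivative Q (at (fibre_part z))"
  have E: "(Q has_derivative ?E) (at (fibre_part z))"
    using Q by (simp add: frechet_derivative_works)
  interpret E: bounded_linear ?E using E by (rule has_derivative_bounded_linear)
  have 1: "((\<lambda>z. Q (fibre_part z)) has_derivative (\<lambda>v. ?E (fibre_part v))) (at z)"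
    by (rule has_derivative_compose[where f=fibre_part,
        OF bounded_linear.has_derivative[OF bounded_linear_fibre_part has_derivative_ident] E])
  have "(xi has_derivative (\<lambda>v. \<alpha> \<bullet> base_part v)) (at z)"
    unfolding xi_def
    by (rule bounded_linear.has_derivative[OF bounded_linear_inner_right],
        rule bounded_linear.has_derivative[OF bounded_linear_base_part has_derivative_ident])
  then have 2: "((\<lambda>z. F (xi z)) has_derivative (\<lambda>v. D * (\<alpha> \<bullet> base_part v))) (at z)"
    by (rule has_derivative_compose[where f=xi, OF _ F[unfolded has_field_derivative_def]])
  note * = partial_eqI[OF has_derivative_mult[OF 2 1]]
  show "partial (Inl i) (\<lambda>z. F (xi z) * Q (fibre_part z)) z = D * \<alpha> $ i * Q (fibre_part z)"
    "partial (Inr a) (\<lambda>z. F (xi z) * Q (fibre_part z)) z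
       = F (xi z) * partial a Q (fibre_part z)"
    by (simp_all only: *) (simp_all add: partial_eqI[OF E] inner_axis E.zero)
qed

lemma partial_xi:
  assumes "(F has_real_derivative D) (at (xi z))"
  shows "partial (Inl i) (\<lambda>z. F (xi z)) z = D * \<alpha> $ i"
    and "partial (Inr a) (\<lambda>z. F (xi z)) z = 0"
  using partial_separated[OF assms, of "\<lambda>_. 1"] by simp_all

lemma partial_fibre:
  fixes z :: "real^('n + 'm)"
  assumes "Q differentiable at (fibre_part z)"
  shows "partial (Inr a) (\<lambda>z. Q (fibre_part z)) z = partial a Q (fibre_part z)"
  using partial_separated[of "\<lambda>_. 1" 0, OF _ assms] by simp

lemma G_simps:
  "G z $ Inl i $ Inl j = (if i = j then \<epsilon> i / (\<phi> (xi z))\<^sup>2 else 0)"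
  "G z $ Inl i $ Inr b = 0" "G z $ Inr a $ Inl j = 0"
  "G z $ Inr a $ Inr b = (f (xi z))\<^sup>2 * P (fibre_part z) $ a $ b"
  by (simp_all add: G_def warped_metric_def conformal_metric_def semi_euclidean_def xi_def)

lemma matrix_inv_G:
  assumes "z \<in> S"
  shows "matrix_inv (G z) $ Inl i $ Inl j = (if i = j then \<epsilon> i * (\<phi> (xi z))\<^sup>2 else 0)"
    and "matrix_inv (G z) $ Inl i $ Inr b = 0" and "matrix_inv (G z) $ Inr a $ Inl j = 0"
    and "matrix_inv (G z) $ Inr a $ Inr b = matrix_inv (P (fibre_part z)) $ a $ b / (f (xi z))\<^sup>2"
proof -
  define H :: "real^('n + 'm)^('n + 'm)" where
    "H = (\<chi> k l. case (k, l) of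
        (Inl i, Inl j) \<Rightarrow> if i = j then \<epsilon> i * (\<phi> (xi z))\<^sup>2 else 0
      | (Inr a, Inr b) \<Rightarrow> matrix_inv (P (fibre_part z)) $ a $ b / (f (xi z))\<^sup>2
      | _ \<Rightarrow> 0)"
  have H: "H $ Inl i $ Inl j = (if i = j then \<epsilon> i * (\<phi> (xi z))\<^sup>2 else 0)"
    "H $ Inl i $ Inr b = 0" "H $ Inr a $ Inl j = 0"
    "H $ Inr a $ Inr b = matrix_inv (P (fibre_part z)) $ a $ b / (f (xi z))\<^sup>2" for i j a b
    by (simp_all add: H_def)
  have "(P (fibre_part z) ** matrix_inv (P (fibre_part z))) $ a $ b = mat 1 $ a $ b" for a b
    using matrix_inv_right[OF P(2), of "fibre_part z"] assms by simp
  then have PI: "(\<Sum>c\<in>UNIV. P (fibre_part z) $ a $ c * matrix_inv (P (fibre_part z)) $ c $ b)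
      = (if a = b then 1 else 0)" for a b
    by (simp add: matrix_matrix_mult_def mat_def)
  have nz: "\<phi> (xi z) \<noteq> 0" "f (xi z) \<noteq> 0" using pos[of "xi z"] by auto
  have "(G z ** H) $ k $ l = mat 1 $ k $ l" for k l
    by (cases k; cases l)
       (use nz eps_sq in \<open>auto simp: matrix_matrix_mult_def mat_def sum_UNIV_Plus G_simps H PI\<close>)
  then have "matrix_inv (G z) = H"
    by (intro matrix_inv_eqI) (simp add: vec_eq_iff)
  then show "matrix_inv (G z) $ Inl i $ Inl j = (if i = j then \<epsilon> i * (\<phi> (xi z))\<^sup>2 else 0)"
    "matrix_inv (G z) $ Inl i $ Inr b = 0" "matrix_inv (G z) $ Inr a $ Inl j = 0"
    "matrix_inv (G z) $ Inr a $ Inr b = matrix_inv (P (fibre_part z)) $ a $ b / (f (xi z))\<^sup>2"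
    by (simp_all add: H)
qed

text \<open>The logarithmic derivatives of \<open>\<phi>\<close> and \<open>f\<close>, and the derivatives of these. Every
  Christoffel symbol with a base index either vanishes or has a factor \<open>p\<close> or \<open>q\<close>.\<close>

definition p :: "real \<Rightarrow> real" where "p t = \<phi>' t / \<phi> t"
definition q :: "real \<Rightarrow> real" where "q t = f' t / f t"
definition p' :: "real \<Rightarrow> real" where "p' t = \<phi>'' t / \<phi> t - (p t)\<^sup>2"
definition q' :: "real \<Rightarrow> real" where "q' t = f'' t / f t - (q t)\<^sup>2"

lemma nz: "\<phi> t \<noteq> 0" "f t \<noteq> 0" using pos[of t] by auto

lemma deriv_p: "(p has_real_derivative p' t) (at t)"
  unfolding p_def[abs_def] p'_def using nz(1)[of t]
  by (auto intro!: derivative_eq_intros deriv simp: field_simps power2_eq_square)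

lemma deriv_q: "(q has_real_derivative q' t) (at t)"
  unfolding q_def[abs_def] q'_def using nz(2)[of t]
  by (auto intro!: derivative_eq_intros deriv simp: field_simps power2_eq_square)

lemma partial_G:
  assumes z: "z \<in> S"
  shows "partial (Inl k) (\<lambda>z. G z $ Inl i $ Inl j) z
           = (if i = j then \<epsilon> i * (- 2 * p (xi z) / (\<phi> (xi z))\<^sup>2) * \<alpha> $ k else 0)"
    and "partial (Inr c) (\<lambda>z. G z $ Inl i $ Inl j) z = 0"
    and "partial (Inl k) (\<lambda>z. G z $ Inr a $ Inr b) z
           = 2 * (f (xi z))\<^sup>2 * q (xi z) * \<alpha> $ k * P (fibre_part z) $ a $ b"
    and "partial (Inr c) (\<lambda>z. G z $ Inr a $ Inr b) z
           = (f (xi z))\<^sup>2 * partial c (\<lambda>y. P y $ a $ b) (fibre_part z)"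
    and "partial r (\<lambda>z. G z $ Inl i $ Inr b) z = 0"
    and "partial r (\<lambda>z. G z $ Inr a $ Inl j) z = 0"
proof -
  have 1: "((\<lambda>t. \<epsilon> i / (\<phi> t)\<^sup>2) has_real_derivative \<epsilon> i * (- 2 * p t / (\<phi> t)\<^sup>2)) (at t)" for t
    using nz(1)[of t] unfolding p_def
    by (auto intro!: derivative_eq_intros deriv simp: field_simps power2_eq_square)
  have 2: "((\<lambda>t. (f t)\<^sup>2) has_real_derivative 2 * (f t)\<^sup>2 * q t) (at t)" for t
    using nz(2)[of t] unfolding q_def
    by (auto intro!: derivative_eq_intros deriv simp: field_simps power2_eq_square)
  have 3: "(\<lambda>y. P y $ a $ b) differentiable at (fibre_part z)"
    using smooth_onD(1)[OF P(3) V] z by simp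
  show "partial (Inl k) (\<lambda>z. G z $ Inl i $ Inl j) z
           = (if i = j then \<epsilon> i * (- 2 * p (xi z) / (\<phi> (xi z))\<^sup>2) * \<alpha> $ k else 0)"
    "partial (Inr c) (\<lambda>z. G z $ Inl i $ Inl j) z = 0"
    using partial_xi[OF 1] by (cases "i = j"; simp add: G_simps)+
  show "partial (Inl k) (\<lambda>z. G z $ Inr a $ Inr b) z
           = 2 * (f (xi z))\<^sup>2 * q (xi z) * \<alpha> $ k * P (fibre_part z) $ a $ b"
    "partial (Inr c) (\<lambda>z. G z $ Inr a $ Inr b) z
           = (f (xi z))\<^sup>2 * partial c (\<lambda>y. P y $ a $ b) (fibre_part z)"
    using partial_separated[OF 2 3] by (simp_all add: G_simps)
qed (simp_all add: G_simps)

lemma christoffel_G: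
  assumes z: "z \<in> S"
  shows "christoffel G (Inl k) (Inl i) (Inl j) z = - p (xi z) *
      (\<alpha> $ i * (if j = k then 1 else 0) + \<alpha> $ j * (if i = k then 1 else 0)
        - \<epsilon> k * \<epsilon> i * \<alpha> $ k * (if i = j then 1 else 0))"
    and "christoffel G (Inr a) (Inl i) (Inl j) z = 0"
    and "christoffel G (Inl k) (Inl i) (Inr b) z = 0"
    and "christoffel G (Inl k) (Inr b) (Inl i) z = 0"
    and "christoffel G (Inr a) (Inl i) (Inr b) z = q (xi z) * \<alpha> $ i * (if a = b then 1 else 0)"
    and "christoffel G (Inr a) (Inr b) (Inl i) z = q (xi z) * \<alpha> $ i * (if a = b then 1 else 0)"
    and "christoffel G (Inl k) (Inr a) (Inr b) z =
      - ((\<phi> (xi z))\<^sup>2 * (f (xi z))\<^sup>2 * q (xi z)) * (\<epsilon> k * \<alpha> $ k) * P (fibre_part z) $ a $ b"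
    and "christoffel G (Inr c) (Inr a) (Inr b) z = christoffel P c a b (fibre_part z)"
proof -
  note nz = nz[of "xi z"]
  note pr = partial_G[OF z] matrix_inv_G[OF z] sum_UNIV_Plus christoffel_def
  have sym: "P (fibre_part z) $ a $ b = P (fibre_part z) $ b $ a" for a b
    using P(1)[of "fibre_part z"] z
    by (metis (mono_tags) mem_Collect_eq transpose_def vec_lambda_beta)
  have "(matrix_inv (P (fibre_part z)) ** P (fibre_part z)) $ a $ b = mat 1 $ a $ b" for a b
    using matrix_inv_right[OF P(2), of "fibre_part z"] z
    by (metis matrix_left_right_inverse mem_Collect_eq)
  then have PI: "(\<Sum>c\<in>UNIV. matrix_inv (P (fibre_part z)) $ a $ c * P (fibre_part z) $ c $ b)
      = (if a = b then 1 else 0)" for a b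
    by (simp add: matrix_matrix_mult_def mat_def)
  have PI': "(\<Sum>l\<in>UNIV. matrix_inv (P (fibre_part z)) $ a $ l / (f (xi z))\<^sup>2 *
       (2 * (f (xi z))\<^sup>2 * q (xi z) * \<alpha> $ i * P (fibre_part z) $ b $ l)) / 2
      = q (xi z) * \<alpha> $ i * (if a = b then 1 else 0)" for a b i
  proof -
    have "(\<Sum>l\<in>UNIV. matrix_inv (P (fibre_part z)) $ a $ l / (f (xi z))\<^sup>2 *
       (2 * (f (xi z))\<^sup>2 * q (xi z) * \<alpha> $ i * P (fibre_part z) $ b $ l))
     = (\<Sum>l\<in>UNIV. 2 * q (xi z) * \<alpha> $ i *
         (matrix_inv (P (fibre_part z)) $ a $ l * P (fibre_part z) $ l $ b))"
      using nz by (intro sum.cong refl) (simp add: sym[of b] field_simps)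
    then show ?thesis by (simp only: sum_distrib_left[symmetric] PI)
  qed
  show "christoffel G (Inl k) (Inl i) (Inl j) z = - p (xi z) *
      (\<alpha> $ i * (if j = k then 1 else 0) + \<alpha> $ j * (if i = k then 1 else 0)
        - \<epsilon> k * \<epsilon> i * \<alpha> $ k * (if i = j then 1 else 0))"
  proof -
    have e: "\<epsilon> k * (\<epsilon> k * x) = x" for k x by (simp add: eps_sq mult.assoc[symmetric])
    show ?thesis using nz by (simp only: pr sum_if_delta) (auto simp: field_simps e)
  qed
  show "christoffel G (Inr a) (Inl i) (Inl j) z = 0"
    by (simp add: pr)
  show "christoffel G (Inl k) (Inl i) (Inr b) z = 0" "christoffel G (Inl k) (Inr b) (Inl i) z = 0"
    by (simp_all add: pr)
  show "christoffel G (Inr a) (Inl i) (Inr b) z = q (xi z) * \<alpha> $ i * (if a = b then 1 else 0)"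
    "christoffel G (Inr a) (Inr b) (Inl i) z = q (xi z) * \<alpha> $ i * (if a = b then 1 else 0)"
    using PI' by (simp_all add: pr)
  show "christoffel G (Inl k) (Inr a) (Inr b) z =
      - ((\<phi> (xi z))\<^sup>2 * (f (xi z))\<^sup>2 * q (xi z)) * (\<epsilon> k * \<alpha> $ k) * P (fibre_part z) $ a $ b"
    by (simp add: pr sum_negf)
  show "christoffel G (Inr c) (Inr a) (Inr b) z = christoffel P c a b (fibre_part z)"
    using nz by (simp add: pr field_simps sum_distrib_left[symmetric])
qed

text \<open>In the fifth equation only the shape of the derivative matters: summed over \<open>k = l\<close>, it
  vanishes because \<open>\<alpha>\<close> is null.\<close>

lemma partial_christoffel_G:
  assumes z: "z \<in> S"
  shows "partial (Inl l) (christoffel G (Inl k) (Inl i) (Inl j)) z = - p' (xi z) * \<alpha> $ l *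
      (\<alpha> $ i * (if j = k then 1 else 0) + \<alpha> $ j * (if i = k then 1 else 0)
        - \<epsilon> k * \<epsilon> i * \<alpha> $ k * (if i = j then 1 else 0))"
    and "partial r (christoffel G (Inr a) (Inl i) (Inl j)) z = 0"
    and "partial r (christoffel G (Inl k) (Inl i) (Inr b)) z = 0"
    and "partial (Inl l) (christoffel G (Inr a) (Inr b) (Inl i)) z
      = q' (xi z) * \<alpha> $ l * \<alpha> $ i * (if a = b then 1 else 0)"
    and "\<exists>w. \<forall>k l. partial (Inl l) (christoffel G (Inl k) (Inr a) (Inr b)) z
      = w * \<alpha> $ l * (\<epsilon> k * \<alpha> $ k)"
    and "partial (Inr d) (christoffel G (Inr c) (Inr a) (Inr b)) z
      = partial d (christoffel P c a b) (fibre_part z)"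
proof -
  note cong = partial_cong_open[OF open_S z]
  have "((\<lambda>t. - p t * c) has_real_derivative - p' t * c) (at t)" for c t
    by (auto intro!: derivative_eq_intros deriv_p)
  note 1 = partial_xi(1)[OF this]
  show "partial (Inl l) (christoffel G (Inl k) (Inl i) (Inl j)) z = - p' (xi z) * \<alpha> $ l *
      (\<alpha> $ i * (if j = k then 1 else 0) + \<alpha> $ j * (if i = k then 1 else 0)
        - \<epsilon> k * \<epsilon> i * \<alpha> $ k * (if i = j then 1 else 0))"
    by (rule trans[OF cong[OF christoffel_G(1)]], assumption, rule trans[OF 1]) simp
  show "partial r (christoffel G (Inr a) (Inl i) (Inl j)) z = 0"
    by (rule trans[OF cong[OF christoffel_G(2)]], assumption) simp
  show "partial r (christoffel G (Inl k) (Inl i) (Inr b)) z = 0"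
    by (rule trans[OF cong[OF christoffel_G(3)]], assumption) simp
  have "((\<lambda>t. q t * c * d) has_real_derivative q' t * c * d) (at t)" for c d t
    by (auto intro!: derivative_eq_intros deriv_q)
  note 2 = partial_xi(1)[OF this]
  show "partial (Inl l) (christoffel G (Inr a) (Inr b) (Inl i)) z
      = q' (xi z) * \<alpha> $ l * \<alpha> $ i * (if a = b then 1 else 0)"
    by (rule trans[OF cong[OF christoffel_G(6)]], assumption, rule trans[OF 2]) simp
  define W' where "W' t = - (2 * (\<phi> t * \<phi>' t) * ((f t)\<^sup>2 * q t)
      + (\<phi> t)\<^sup>2 * (2 * (f t * f' t) * q t + (f t)\<^sup>2 * q' t))" for t
  have W: "((\<lambda>t. - ((\<phi> t)\<^sup>2 * (f t)\<^sup>2 * q t) * c) has_real_derivative W' t * c) (at t)" for c t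
    unfolding W'_def by (auto intro!: derivative_eq_intros deriv deriv_q simp: algebra_simps)
  have "(\<lambda>y. P y $ a $ b) differentiable at (fibre_part z)"
    using smooth_onD(1)[OF P(3) V] z by simp
  note 3 = partial_separated(1)[OF W this]
  have "partial (Inl l) (christoffel G (Inl k) (Inr a) (Inr b)) z
      = W' (xi z) * P (fibre_part z) $ a $ b * \<alpha> $ l * (\<epsilon> k * \<alpha> $ k)" for k l
    by (rule trans[OF cong[OF christoffel_G(7)]], assumption, rule trans[OF 3])
       (simp add: algebra_simps)
  then show "\<exists>w. \<forall>k l. partial (Inl l) (christoffel G (Inl k) (Inr a) (Inr b)) z
      = w * \<alpha> $ l * (\<epsilon> k * \<alpha> $ k)" by blast
  have "christoffel P c a b differentiable at (fibre_part z)"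
    using z by (intro christoffel_differentiable[OF V _ P(2,3)]) auto
  note 4 = partial_fibre[OF this]
  show "partial (Inr d) (christoffel G (Inr c) (Inr a) (Inr b)) z
      = partial d (christoffel P c a b) (fibre_part z)"
    by (rule trans[OF cong[OF christoffel_G(8)]], assumption, rule 4)
qed

lemma sum_christoffel_G:
  assumes z: "z \<in> S"
  shows "(\<Sum>k\<in>UNIV. christoffel G (Inl k) (Inl k) (Inl j) z)
           = - (real CARD('n) * p (xi z)) * \<alpha> $ j"
    and "(\<Sum>a\<in>UNIV. christoffel G (Inr a) (Inr a) (Inl j) z)
           = real CARD('m) * q (xi z) * \<alpha> $ j"
proof -
  have "christoffel G (Inl k) (Inl k) (Inl j) z = - p (xi z) * \<alpha> $ j" for k
    by (simp add: christoffel_G[OF z] eps_sq)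
  then show "(\<Sum>k\<in>UNIV. christoffel G (Inl k) (Inl k) (Inl j) z)
           = - (real CARD('n) * p (xi z)) * \<alpha> $ j" by simp
qed (simp add: christoffel_G[OF z])

text \<open>The base Christoffel symbol \<open>\<Gamma>\<^sup>k\<^sub>i\<^sub>j\<close> is \<open>- p\<close> times the bracket; contracting
  the upper index with \<open>\<alpha>\<close> leaves only a multiple of \<open>\<alpha>\<^sub>i \<alpha>\<^sub>j\<close>,
  since the diagonal term is multiplied by \<open>\<parallel>\<alpha>\<parallel>\<^sup>2 = 0\<close>.\<close>

lemma sum_christoffel_alpha:
  "(\<Sum>k\<in>UNIV. (\<alpha> $ i * (if j = k then 1 else 0) + \<alpha> $ j * (if i = k then 1 else 0)
        - \<epsilon> k * \<epsilon> i * \<alpha> $ k * (if i = j then 1 else 0)) * \<alpha> $ k) = 2 * (\<alpha> $ i * \<alpha> $ j)"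
proof -
  have "(\<alpha> $ i * (if j = k then 1 else 0) + \<alpha> $ j * (if i = k then 1 else 0)
        - \<epsilon> k * \<epsilon> i * \<alpha> $ k * (if i = j then 1 else 0)) * \<alpha> $ k =
    \<alpha> $ i * ((if j = k then 1 else 0) * \<alpha> $ k) + \<alpha> $ j * ((if i = k then 1 else 0) * \<alpha> $ k)
     - (if i = j then \<epsilon> i else 0) * (\<epsilon> k * (\<alpha> $ k * \<alpha> $ k))" for k
    by (simp add: algebra_simps)
  then show ?thesis
    by (simp add: sum.distrib sum_subtractf sum_distrib_left[symmetric] null_sum0 del: mult_1)
qed

text \<open>The same bracket, now with lower indices \<open>j, r\<close> and upper index \<open>i\<close>, contracted over the lower
  index \<open>r\<close>; used for the quadratic term \<open>\<Gamma>\<^sup>i\<^sub>j\<^sub>r \<Gamma>\<^sup>r\<^sub>i\<^sub>k\<close> of the Ricci tensor.\<close>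

lemma sum_christoffel_contract:
  "(\<Sum>r\<in>UNIV. (\<alpha> $ j * (if r = i then 1 else 0) + \<alpha> $ r * (if j = i then 1 else 0)
        - \<epsilon> i * \<epsilon> j * \<alpha> $ i * (if j = r then 1 else 0)) * X r) =
   \<alpha> $ j * X i + (if j = i then 1 else 0) * (\<Sum>r\<in>UNIV. \<alpha> $ r * X r) - \<epsilon> i * \<epsilon> j * \<alpha> $ i * X j"
proof -
  have "(\<alpha> $ j * (if r = i then 1 else 0) + \<alpha> $ r * (if j = i then 1 else 0)
        - \<epsilon> i * \<epsilon> j * \<alpha> $ i * (if j = r then 1 else 0)) * X r =
    \<alpha> $ j * ((if r = i then 1 else 0) * X r) + (if j = i then 1 else 0) * (\<alpha> $ r * X r)
     - \<epsilon> i * \<epsilon> j * \<alpha> $ i * ((if j = r then 1 else 0) * X r)" for r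
    by (simp add: algebra_simps)
  then show ?thesis
    by (simp add: sum.distrib sum_subtractf sum_distrib_left[symmetric] del: mult_1)
qed

text \<open>A function of \<open>\<xi>\<close> has a Hessian proportional to \<open>\<alpha>\<^sub>i \<alpha>\<^sub>j\<close> on the base and vanishing on the
  fibre: the remaining terms contain \<open>g(\<nabla>\<phi>, \<nabla>H)\<close> or \<open>g(\<nabla>f, \<nabla>H)\<close>, which are multiples of \<open>\<parallel>\<alpha>\<parallel>\<^sup>2\<close>.\<close>

lemma hessian_G:
  assumes z: "z \<in> S" and H: "\<And>t. (H has_real_derivative H' t) (at t)"
     "\<And>t. (H' has_real_derivative H'' t) (at t)"
  shows "hessian G (\<lambda>z. H (xi z)) z $ Inl i $ Inl j
       = (H'' (xi z) + 2 * p (xi z) * H' (xi z)) * (\<alpha> $ i * \<alpha> $ j)"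
    and "hessian G (\<lambda>z. H (xi z)) z $ Inr a $ Inr b = 0"
proof -
  have 1: "partial (Inl j) (\<lambda>z. H (xi z)) = (\<lambda>z. H' (xi z) * \<alpha> $ j)" for j
    using partial_xi(1)[OF H(1)] by auto
  have 2: "partial (Inr b) (\<lambda>z. H (xi z)) = (\<lambda>z. 0)" for b
    using partial_xi(2)[OF H(1)] by auto
  have 3: "partial (Inl i) (\<lambda>z. H' (xi z) * \<alpha> $ j) z = H'' (xi z) * \<alpha> $ i * \<alpha> $ j"
    using partial_separated(1)[OF H(2), of "\<lambda>_. \<alpha> $ j"] by simp
  have "(\<Sum>k\<in>UNIV. christoffel G (Inl k) (Inl i) (Inl j) z * (H' (xi z) * \<alpha> $ k))
     = (\<Sum>k\<in>UNIV. - p (xi z) * H' (xi z) *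
      ((\<alpha> $ i * (if j = k then 1 else 0) + \<alpha> $ j * (if i = k then 1 else 0)
        - \<epsilon> k * \<epsilon> i * \<alpha> $ k * (if i = j then 1 else 0)) * \<alpha> $ k))"
    by (intro sum.cong refl) (simp add: christoffel_G(1)[OF z])
  also have "\<dots> = - 2 * p (xi z) * H' (xi z) * (\<alpha> $ i * \<alpha> $ j)"
    by (simp only: sum_distrib_left[symmetric] sum_christoffel_alpha)
  finally show "hessian G (\<lambda>z. H (xi z)) z $ Inl i $ Inl j
       = (H'' (xi z) + 2 * p (xi z) * H' (xi z)) * (\<alpha> $ i * \<alpha> $ j)"
    by (simp add: hessian_def 1 2 3 sum_UNIV_Plus) (simp add: algebra_simps)
  have "(\<Sum>k\<in>UNIV. christoffel G (Inl k) (Inr a) (Inr b) z * (H' (xi z) * \<alpha> $ k))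
      = (\<Sum>k\<in>UNIV. - ((\<phi> (xi z))\<^sup>2 * (f (xi z))\<^sup>2 * q (xi z)) * P (fibre_part z) $ a $ b
          * H' (xi z) * (\<epsilon> k * (\<alpha> $ k * \<alpha> $ k)))"
    by (intro sum.cong refl) (simp add: christoffel_G(7)[OF z])
  also have "\<dots> = 0" by (rule null_sum)
  finally show "hessian G (\<lambda>z. H (xi z)) z $ Inr a $ Inr b = 0"
    by (simp add: hessian_def 1 2 sum_UNIV_Plus)
qed

lemma sum_swap_mult:
  fixes g :: "'x::finite \<Rightarrow> 'y::finite \<Rightarrow> real"
  shows "(\<Sum>r\<in>UNIV. (\<Sum>i\<in>UNIV. g i r) * x r) = (\<Sum>i\<in>UNIV. \<Sum>r\<in>UNIV. g i r * x r)"
  by (simp add: sum_distrib_right) (rule sum.swap)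

text \<open>The difference of the two sides is, in general, a combination of \<open>\<Delta>f\<close> and \<open>|\<nabla>f|\<^sup>2\<close> on the
  base times the fibre metric; every term of it contains the factor \<open>\<parallel>\<alpha>\<parallel>\<^sup>2 = 0\<close>.\<close>

lemma ricci_G_fibre:
  assumes z: "z \<in> S"
  shows "ricci G z $ Inr b $ Inr c = ricci P (fibre_part z) $ b $ c"
proof -
  let ?\<Gamma> = "\<lambda>k i j. christoffel G k i j z"
  let ?W = "- ((\<phi> (xi z))\<^sup>2 * (f (xi z))\<^sup>2 * q (xi z))"
  have "(\<Sum>i\<in>UNIV. partial (Inl i) (christoffel G (Inl i) (Inr b) (Inr c)) z) = 0"
  proof -
    obtain w where w: "\<And>k l. partial (Inl l) (christoffel G (Inl k) (Inr b) (Inr c)) z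
        = w * \<alpha> $ l * (\<epsilon> k * \<alpha> $ k)"
      using partial_christoffel_G(5)[OF z] by blast
    have "(\<Sum>i\<in>UNIV. partial (Inl i) (christoffel G (Inl i) (Inr b) (Inr c)) z)
        = (\<Sum>i\<in>UNIV. w * (\<epsilon> i * (\<alpha> $ i * \<alpha> $ i)))"
      by (intro sum.cong refl) (simp add: w)
    then show ?thesis by (simp only: null_sum)
  qed
  moreover have s: "(\<Sum>r\<in>UNIV. c' * \<alpha> $ r * ?\<Gamma> (Inl r) (Inr a) (Inr d)) = 0" for c' a d
  proof -
    have "(\<Sum>r\<in>UNIV. c' * \<alpha> $ r * ?\<Gamma> (Inl r) (Inr a) (Inr d))
        = (\<Sum>r\<in>UNIV. c' * ?W * P (fibre_part z) $ a $ d * (\<epsilon> r * (\<alpha> $ r * \<alpha> $ r)))"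
      by (intro sum.cong refl) (simp add: christoffel_G(7)[OF z])
    then show ?thesis by (simp only: null_sum)
  qed
  moreover have "(\<Sum>r\<in>UNIV. (\<Sum>i\<in>UNIV. ?\<Gamma> (Inl i) (Inl i) (Inl r)) * ?\<Gamma> (Inl r) (Inr b) (Inr c)) = 0"
    "(\<Sum>r\<in>UNIV. (\<Sum>a\<in>UNIV. ?\<Gamma> (Inr a) (Inr a) (Inl r)) * ?\<Gamma> (Inl r) (Inr b) (Inr c)) = 0"
    by (simp_all only: sum_christoffel_G[OF z] s)
  moreover have "(\<Sum>i\<in>UNIV. \<Sum>d\<in>UNIV. ?\<Gamma> (Inl i) (Inr b) (Inr d) * ?\<Gamma> (Inr d) (Inl i) (Inr c)) = 0"
  proof -
    have "(\<Sum>d\<in>UNIV. ?\<Gamma> (Inl i) (Inr b) (Inr d) * ?\<Gamma> (Inr d) (Inl i) (Inr c))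
        = q (xi z) * \<alpha> $ i * ?\<Gamma> (Inl i) (Inr b) (Inr c)" for i
      by (simp add: christoffel_G(5)[OF z] if_distrib cong: if_cong)
    then show ?thesis by (simp only: s)
  qed
  moreover have "(\<Sum>a\<in>UNIV. \<Sum>r\<in>UNIV. ?\<Gamma> (Inr a) (Inr b) (Inl r) * ?\<Gamma> (Inl r) (Inr a) (Inr c)) = 0"
  proof -
    have "(\<Sum>r\<in>UNIV. ?\<Gamma> (Inr a) (Inr b) (Inl r) * ?\<Gamma> (Inl r) (Inr a) (Inr c)) =
      (\<Sum>r\<in>UNIV. (q (xi z) * (if a = b then 1 else 0)) * \<alpha> $ r * ?\<Gamma> (Inl r) (Inr a) (Inr c))" for a
      by (intro sum.cong refl) (simp add: christoffel_G(6)[OF z])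
    then show ?thesis by (simp only: s) simp
  qed
  \<comment> \<open>Every other term of \<open>Ric\<close> with a summation index on the base has a vanishing factor.\<close>
  ultimately show ?thesis
    by (simp add: ricci_def curvature_def sum_UNIV_Plus christoffel_G(3,4,8)[OF z]
        partial_christoffel_G(3,6)[OF z] sum.distrib sum_subtractf sum_swap_mult)
qed

text \<open>The factor \<open>w\<close> is \<open>(n - 2) \<phi>'' / \<phi> - m (f'' / f + 2 \<phi>' f' / (\<phi> f))\<close>, written in terms of \<open>p\<close>, \<open>q\<close>
  and their derivatives.\<close>

lemma ricci_G_base:
  assumes z: "z \<in> S"
  shows "\<exists>w. \<forall>j k. ricci G z $ Inl j $ Inl k = w * (\<alpha> $ j * \<alpha> $ k)"
proof (intro exI allI)
  fix j k
  let ?\<Gamma> = "\<lambda>k i j. christoffel G k i j z"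
  let ?n = "real CARD('n)" and ?m = "real CARD('m)" and ?p = "p (xi z)" and ?q = "q (xi z)"
  let ?T = "\<lambda>i. \<alpha> $ j * (if k = i then 1 else 0) + \<alpha> $ k * (if j = i then 1 else 0)
        - \<epsilon> i * \<epsilon> j * \<alpha> $ i * (if j = k then 1 else 0)"
  have "(\<Sum>i\<in>UNIV. partial (Inl i) (christoffel G (Inl i) (Inl j) (Inl k)) z)
      = (\<Sum>i\<in>UNIV. - p' (xi z) * (?T i * \<alpha> $ i))"
    by (intro sum.cong refl) (simp add: partial_christoffel_G(1)[OF z])
  also have "\<dots> = - 2 * p' (xi z) * (\<alpha> $ j * \<alpha> $ k)"
    by (simp only: sum_distrib_left[symmetric] sum_christoffel_alpha)
  finally have D1: "(\<Sum>i\<in>UNIV. partial (Inl i) (christoffel G (Inl i) (Inl j) (Inl k)) z)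
      = - 2 * p' (xi z) * (\<alpha> $ j * \<alpha> $ k)" .
  have "partial (Inl j) (christoffel G (Inl i) (Inl i) (Inl k)) z
      = - p' (xi z) * (\<alpha> $ j * \<alpha> $ k)" for i
    by (simp add: partial_christoffel_G(1)[OF z] eps_sq)
  then have D2: "(\<Sum>i\<in>UNIV. partial (Inl j) (christoffel G (Inl i) (Inl i) (Inl k)) z)
      = - ?n * p' (xi z) * (\<alpha> $ j * \<alpha> $ k)" by simp
  have D3: "(\<Sum>a\<in>UNIV. partial (Inl j) (christoffel G (Inr a) (Inr a) (Inl k)) z)
      = ?m * q' (xi z) * (\<alpha> $ j * \<alpha> $ k)"
    by (simp add: partial_christoffel_G(4)[OF z])
  have Q: "(\<Sum>r\<in>UNIV. c * \<alpha> $ r * ?\<Gamma> (Inl r) (Inl j) (Inl k)) = - 2 * c * ?p * (\<alpha> $ j * \<alpha> $ k)" for c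
  proof -
    have "(\<Sum>r\<in>UNIV. c * \<alpha> $ r * ?\<Gamma> (Inl r) (Inl j) (Inl k)) = (\<Sum>r\<in>UNIV. - c * ?p * (?T r * \<alpha> $ r))"
      by (intro sum.cong refl) (simp add: christoffel_G(1)[OF z])
    then show ?thesis by (simp only: sum_distrib_left[symmetric] sum_christoffel_alpha)
  qed
  have Q1: "(\<Sum>r\<in>UNIV. (\<Sum>i\<in>UNIV. ?\<Gamma> (Inl i) (Inl i) (Inl r)) * ?\<Gamma> (Inl r) (Inl j) (Inl k))
        = 2 * ?n * ?p\<^sup>2 * (\<alpha> $ j * \<alpha> $ k)"
    "(\<Sum>r\<in>UNIV. (\<Sum>a\<in>UNIV. ?\<Gamma> (Inr a) (Inr a) (Inl r)) * ?\<Gamma> (Inl r) (Inl j) (Inl k))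
        = - 2 * ?m * ?p * ?q * (\<alpha> $ j * \<alpha> $ k)"
    by (simp_all only: sum_christoffel_G[OF z] Q) (simp_all add: power2_eq_square)
  have Q2: "(\<Sum>a\<in>UNIV. \<Sum>b\<in>UNIV. ?\<Gamma> (Inr a) (Inl j) (Inr b) * ?\<Gamma> (Inr b) (Inr a) (Inl k))
      = ?m * ?q\<^sup>2 * (\<alpha> $ j * \<alpha> $ k)"
    by (simp add: christoffel_G(5,6)[OF z] if_distrib power2_eq_square cong: if_cong)
  have Q3: "(\<Sum>i\<in>UNIV. \<Sum>r\<in>UNIV. ?\<Gamma> (Inl i) (Inl j) (Inl r) * ?\<Gamma> (Inl r) (Inl i) (Inl k))
      = (?n + 2) * ?p\<^sup>2 * (\<alpha> $ j * \<alpha> $ k)"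
  proof -
    let ?X = "\<lambda>i r. \<alpha> $ i * (if k = r then 1 else 0) + \<alpha> $ k * (if i = r then 1 else 0)
          - \<epsilon> r * \<epsilon> i * \<alpha> $ r * (if i = k then 1 else 0)"
    have e: "\<epsilon> i * (\<epsilon> i * x) = x" for i x by (simp add: eps_sq mult.assoc[symmetric])
    have inner: "(\<Sum>r\<in>UNIV. ?\<Gamma> (Inl i) (Inl j) (Inl r) * ?\<Gamma> (Inl r) (Inl i) (Inl k))
      = ?p\<^sup>2 * (\<alpha> $ j * ?X i i + (if j = i then 1 else 0) * (2 * (\<alpha> $ i * \<alpha> $ k))
               - \<epsilon> i * \<epsilon> j * \<alpha> $ i * ?X i j)" for i
    proof -
      have "(\<Sum>r\<in>UNIV. ?\<Gamma> (Inl i) (Inl j) (Inl r) * ?\<Gamma> (Inl r) (Inl i) (Inl k))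
        = (\<Sum>r\<in>UNIV. ?p\<^sup>2 * ((\<alpha> $ j * (if r = i then 1 else 0) + \<alpha> $ r * (if j = i then 1 else 0)
        - \<epsilon> i * \<epsilon> j * \<alpha> $ i * (if j = r then 1 else 0)) * ?X i r))"
        by (intro sum.cong refl) (simp only: christoffel_G(1)[OF z], simp add: power2_eq_square)
      moreover have "(\<Sum>r\<in>UNIV. \<alpha> $ r * ?X i r) = 2 * (\<alpha> $ i * \<alpha> $ k)"
        using sum_christoffel_alpha[of i k] by (simp only: mult.commute)
      ultimately show ?thesis
        by (simp only: sum_distrib_left[symmetric] sum_christoffel_contract)
    qed
    have alg: "\<alpha> $ j * ?X i i + (if j = i then 1 else 0) * (2 * (\<alpha> $ i * \<alpha> $ k))
               - \<epsilon> i * \<epsilon> j * \<alpha> $ i * ?X i j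
        = \<alpha> $ j * \<alpha> $ k + (if j = i then 1 else 0) * (\<alpha> $ j * \<alpha> $ k)
          + (if k = i then 1 else 0) * (\<alpha> $ j * \<alpha> $ k)
          - (if k = j then \<epsilon> j else 0) * (\<epsilon> i * (\<alpha> $ i * \<alpha> $ i))" for i
      by (auto simp: algebra_simps eps_sq e)
    show ?thesis
      by (simp only: inner alg sum_distrib_left[symmetric] sum.distrib sum_subtractf sum_if_delta null_sum0)
         (simp add: algebra_simps)
  qed
  show "ricci G z $ Inl j $ Inl k
      = ((?n - 2) * p' (xi z) - ?m * q' (xi z) + (?n - 2) * ?p\<^sup>2 - 2 * ?m * ?p * ?q - ?m * ?q\<^sup>2)
        * (\<alpha> $ j * \<alpha> $ k)"
  proof -
    \<comment> \<open>The definition of \<open>Ric\<close> with every sum split into base and fibre indices; the products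
      left out have a vanishing factor.\<close>
    have "ricci G z $ Inl j $ Inl k =
      (\<Sum>i\<in>UNIV. partial (Inl i) (christoffel G (Inl i) (Inl j) (Inl k)) z)
      - (\<Sum>i\<in>UNIV. partial (Inl j) (christoffel G (Inl i) (Inl i) (Inl k)) z)
      - (\<Sum>a\<in>UNIV. partial (Inl j) (christoffel G (Inr a) (Inr a) (Inl k)) z)
      + (\<Sum>r\<in>UNIV. (\<Sum>i\<in>UNIV. ?\<Gamma> (Inl i) (Inl i) (Inl r)) * ?\<Gamma> (Inl r) (Inl j) (Inl k))
      + (\<Sum>r\<in>UNIV. (\<Sum>a\<in>UNIV. ?\<Gamma> (Inr a) (Inr a) (Inl r)) * ?\<Gamma> (Inl r) (Inl j) (Inl k))
      - (\<Sum>a\<in>UNIV. \<Sum>b\<in>UNIV. ?\<Gamma> (Inr a) (Inl j) (Inr b) * ?\<Gamma> (Inr b) (Inr a) (Inl k))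
      - (\<Sum>i\<in>UNIV. \<Sum>r\<in>UNIV. ?\<Gamma> (Inl i) (Inl j) (Inl r) * ?\<Gamma> (Inl r) (Inl i) (Inl k))"
      by (simp add: ricci_def curvature_def sum_UNIV_Plus christoffel_G(2,3,4)[OF z]
        partial_christoffel_G(2,3)[OF z] sum.distrib sum_subtractf sum_swap_mult)
    then show ?thesis
      by (simp only: D1 D2 D3 Q1 Q2 Q3) (simp add: algebra_simps)
  qed
qed

end

section \<open>The soliton equation in a product chart\<close>

lemma homeomorphic_chart:
  assumes "smooth_manifold F"
  shows "open (chart_image F d)"
    and "p \<in> chart_dom F d \<Longrightarrow> chart_inv F d (chart_map F d p) = p"
    and "y \<in> chart_image F d \<Longrightarrow> chart_inv F d y \<in> chart_dom F d"
    and "y \<in> chart_image F d \<Longrightarrow> chart_map F d (chart_inv F d y) = y"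
  using assms unfolding smooth_manifold_def homeomorphism_def by blast+

lemma chart_inv_prod_euclidean:
  fixes F :: "('c, 'f::{t2_space,second_countable_topology}, 'm::finite) atlas"
    and w :: "real^('n::finite + 'm)"
  assumes F: "smooth_manifold F" and w: "fibre_part w \<in> chart_image F d"
  shows "chart_inv (prod_atlas euclidean_atlas F) ((), d) w
    = (base_part w, chart_inv F d (fibre_part w))"
proof -
  let ?A = "prod_atlas (euclidean_atlas :: (unit, real^'n, 'n) atlas) F"
  have A: "chart_dom ?A ((), d) = UNIV \<times> chart_dom F d"
    "chart_map ?A ((), d) (x, q) = join x (chart_map F d q)" for x q
    by (simp_all add: prod_atlas_def euclidean_atlas_def)
  have "inj_on (chart_map ?A ((), d)) (chart_dom ?A ((), d))"
  proof (rule inj_onI)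
    fix s t :: "(real^'n) \<times> 'f"
    assume s: "s \<in> chart_dom ?A ((), d)" and t: "t \<in> chart_dom ?A ((), d)"
      and eq: "chart_map ?A ((), d) s = chart_map ?A ((), d) t"
    obtain x q x' q' where st: "s = (x, q)" "t = (x', q')" by (cases s; cases t)
    from eq have j: "join x (chart_map F d q) = join x' (chart_map F d q')" by (simp add: st A)
    from arg_cong[OF j, of base_part] have "x = x'" by simp
    moreover from arg_cong[OF j, of fibre_part] have "chart_map F d q = chart_map F d q'" by simp
    then have "q = q'" using s t homeomorphic_chart(2)[OF F] by (metis A(1) SigmaD2 st)
    ultimately show "s = t" by (simp add: st)
  qed
  then show ?thesis
    unfolding chart_inv_def[of ?A]
    by (rule inv_into_f_eq) (simp_all add: A homeomorphic_chart[OF F] w)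
qed

theorem corollary1p7:
  fixes \<epsilon> :: "'n::finite \<Rightarrow> real"
    and \<alpha> :: "real^'n"
    and \<phi> f h u :: "real^'n \<Rightarrow> real"
    and F :: "('c, 'f::{t2_space,second_countable_topology}, 'm::finite) atlas"
    and gF :: "('c, 'f, 'm) tensor2"
    and lam :: real
  assumes "\<And>i. \<epsilon> i = 1 \<or> \<epsilon> i = - 1"
    and "\<alpha> \<noteq> 0"
    and "smooth_on \<phi> UNIV" and "smooth_on f UNIV" and "smooth_on h UNIV" and "smooth_on u UNIV"
    and "\<And>x. \<phi> x > 0" and "\<And>x. f x > 0"
    and "depends_only_on_xi \<alpha> \<phi>" and "depends_only_on_xi \<alpha> f"
    and "depends_only_on_xi \<alpha> h" and "depends_only_on_xi \<alpha> u"
    and "\<not> u constant_on UNIV"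
    and "semi_riemannian F gF"
    and "grhs (prod_atlas euclidean_atlas F)
           (warped_metric (conformal_metric \<epsilon> \<phi>) f gF)
           (\<lambda>(x, q). h x) (\<lambda>(x, q). u x) lam"
    and "semi_norm_sq \<epsilon> \<alpha> = 0"
  shows "lam = 0 \<and> ricci_flat F gF \<and> (\<forall>\<mu>. einstein_with F gF \<mu> \<longrightarrow> \<mu> = 0)"
proof -
  have F: "smooth_manifold F"
    and gF_inv: "\<And>d q. q \<in> chart_dom F d \<Longrightarrow> invertible (gF d q)"
    and gF_sym: "\<And>d q. q \<in> chart_dom F d \<Longrightarrow> transpose (gF d q) = gF d q"
    and gF_smooth: "\<And>d a b. smooth_on (\<lambda>y. gF d (chart_inv F d y) $ a $ b) (chart_image F d)"
    using assms(14) unfolding semi_riemannian_def by blast+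
  obtain r r' r'' where r: "\<And>x. \<phi> x = r (\<alpha> \<bullet> x)"
    "\<And>t. (r has_real_derivative r' t) (at t)" "\<And>t. (r' has_real_derivative r'' t) (at t)"
    using smooth_profile[OF assms(2,3,9)] by blast
  obtain s s' s'' where s: "\<And>x. f x = s (\<alpha> \<bullet> x)"
    "\<And>t. (s has_real_derivative s' t) (at t)" "\<And>t. (s' has_real_derivative s'' t) (at t)"
    using smooth_profile[OF assms(2,4,10)] by blast
  obtain H H' H'' where H: "\<And>x. h x = H (\<alpha> \<bullet> x)"
    "\<And>t. (H has_real_derivative H' t) (at t)" "\<And>t. (H' has_real_derivative H'' t) (at t)"
    using smooth_profile[OF assms(2,5,11)] by blast
  obtain U U' U'' where U: "\<And>x. u x = U (\<alpha> \<bullet> x)"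
    "\<And>t. (U has_real_derivative U' t) (at t)" "\<And>t. (U' has_real_derivative U'' t) (at t)"
    using smooth_profile[OF assms(2,6,12)] by blast
  have profiles: "\<phi> = (\<lambda>x. r (\<alpha> \<bullet> x))" "f = (\<lambda>x. s (\<alpha> \<bullet> x))"
    using r(1) s(1) by auto
  have onto: "\<exists>x. \<alpha> \<bullet> x = t" for t
    using assms(2) by (intro exI[of _ "(t / (\<alpha> \<bullet> \<alpha>)) *\<^sub>R \<alpha>"]) simp
  let ?A = "prod_atlas euclidean_atlas F"
  let ?g = "warped_metric (conformal_metric \<epsilon> \<phi>) f gF"
  let ?h = "\<lambda>(x, q). h x" and ?u = "\<lambda>(x, q). u x"
  obtain \<theta> where \<theta>: "\<And>c p. p \<in> chart_dom ?A c \<Longrightarrow>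
      ricci_tensor ?A ?g c p + hessian_tensor ?A ?g ?h c p - \<theta> *\<^sub>R grad_tensor_grad ?A ?u c p
        = lam *\<^sub>R ?g c p"
    using assms(15) unfolding grhs_def by blast
  have null: "(\<Sum>i\<in>UNIV. \<epsilon> i * (\<alpha> $ i)\<^sup>2) = 0" using assms(16) by (simp add: semi_norm_sq_def)
  have eps: "\<epsilon> i * \<epsilon> i = 1" for i using assms(1)[of i] by auto
  \<comment> \<open>The base and fibre blocks of the soliton equation, over the origin of the base. The Ricci
    tensor, the Hessian and \<open>\<nabla>u \<otimes> \<nabla>u\<close> contribute only multiples of \<open>\<alpha>\<^sub>i \<alpha>\<^sub>j\<close> to the base block,
    and only \<open>Ric\<^sub>F\<close> to the fibre block.\<close>
  have equations:
    "(\<exists>w. \<forall>i j. w * (\<alpha> $ i * \<alpha> $ j) = lam * (if i = j then \<epsilon> i / (\<phi> 0)\<^sup>2 else 0)) \<and>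
     ricci_tensor F gF d q = (lam * (f 0)\<^sup>2) *\<^sub>R gF d q" if q: "q \<in> chart_dom F d" for d q
  proof -
    let ?P = "gF d \<circ> chart_inv F d" and ?V = "chart_image F d"
    interpret null_warped_product \<epsilon> \<alpha> r r' r'' s s' s'' ?P ?V
    proof
      show "r t > 0" "s t > 0" for t using onto[of t] assms(7,8) r(1) s(1) by metis+
      show "open ?V" by (rule homeomorphic_chart(1)[OF F])
      show "transpose (?P y) = ?P y" "invertible (?P y)" if "y \<in> ?V" for y
        using that by (simp_all add: gF_sym gF_inv homeomorphic_chart[OF F])
      show "smooth_on (\<lambda>y. ?P y $ a $ b) ?V" for a b using gF_smooth by simp
    qed (fact eps null r s)+
    define z :: "real^('n + 'm)" where "z = join 0 (chart_map F d q)"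
    have zV: "fibre_part z \<in> ?V" using q by (simp add: z_def chart_image_def)
    then have z: "z \<in> S" by simp
    have xi0: "xi z = 0" by (simp add: xi_def z_def)
    let ?c = "((), d)"
    have mem: "(0, q) \<in> chart_dom ?A ?c" and map: "chart_map ?A ?c (0, q) = z"
      using q by (simp_all add: prod_atlas_def euclidean_atlas_def z_def)
    have inv: "chart_inv ?A ?c w = (base_part w, chart_inv F d (fibre_part w))" if "w \<in> S" for w
      using chart_inv_prod_euclidean[OF F] that by blast
    have g: "(?g ?c \<circ> chart_inv ?A ?c) w = G w" if "w \<in> S" for w
      unfolding profiles G_def unfolding o_def
      by (simp add: inv[OF that] warped_metric_def conformal_metric_def)
    have hh: "(?h \<circ> chart_inv ?A ?c) w = H (xi w)" and uu: "(?u \<circ> chart_inv ?A ?c) w = U (xi w)"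
      if "w \<in> S" for w
      using inv[OF that] by (simp_all add: H(1) U(1) xi_def)
    have Ric: "ricci_tensor ?A ?g ?c (0, q) = ricci G z"
      unfolding ricci_tensor_def map by (rule ricci_cong_open[OF open_S z g])
    have Hess: "hessian_tensor ?A ?g ?h ?c (0, q) = hessian G (\<lambda>z. H (xi z)) z"
      unfolding hessian_tensor_def map by (rule hessian_cong_open[OF open_S z g hh])
    have du: "partial k (?u \<circ> chart_inv ?A ?c) z = partial k (\<lambda>z. U (xi z)) z" for k
      by (rule partial_cong_open[OF open_S z uu])
    have gz: "?g ?c (0, q) = G z"
      using g[OF z] inv[OF z] q by (simp add: z_def homeomorphic_chart[OF F])
    have eq: "ricci G z $ k $ l + hessian G (\<lambda>z. H (xi z)) z $ k $ l
        - \<theta> * (partial k (\<lambda>z. U (xi z)) z * partial l (\<lambda>z. U (xi z)) z) = lam * G z $ k $ l" for k l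
      using arg_cong[OF \<theta>[OF mem], of "\<lambda>M. M $ k $ l"]
      by (simp add: Ric Hess gz grad_tensor_grad_def map du)
    obtain w where w: "\<And>i j. ricci G z $ Inl i $ Inl j = w * (\<alpha> $ i * \<alpha> $ j)"
      using ricci_G_base[OF z] by blast
    have "(w + (H'' 0 + 2 * p 0 * H' 0) - \<theta> * (U' 0)\<^sup>2) * (\<alpha> $ i * \<alpha> $ j)
        = lam * (if i = j then \<epsilon> i / (\<phi> 0)\<^sup>2 else 0)" for i j
      using eq[of "Inl i" "Inl j"]
      by (simp add: w hessian_G(1)[OF z H(2,3)] partial_xi(1)[OF U(2)] xi0 G_simps r(1)
          algebra_simps power2_eq_square)
    moreover
    have "ricci_tensor F gF d q $ a $ b = ((lam * (f 0)\<^sup>2) *\<^sub>R gF d q) $ a $ b" for a b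
      using eq[of "Inr a" "Inr b"] q
      by (simp add: ricci_G_fibre[OF z] hessian_G(2)[OF z H(2,3)] partial_xi(2)[OF U(2)] xi0
          G_simps s(1) ricci_tensor_def) (simp add: z_def homeomorphic_chart[OF F])
    then have "ricci_tensor F gF d q = (lam * (f 0)\<^sup>2) *\<^sub>R gF d q"
      by (simp only: vec_eq_iff) blast
    ultimately show ?thesis by blast
  qed
  have "\<exists>d q. q \<in> chart_dom F d" using F unfolding smooth_manifold_def by blast
  then obtain d0 q0 where q0: "q0 \<in> chart_dom F d0" by blast
  obtain w where w: "\<And>i j. w * (\<alpha> $ i * \<alpha> $ j) = lam * (if i = j then \<epsilon> i / (\<phi> 0)\<^sup>2 else 0)"
    using equations[OF q0] by blast
  obtain i where i: "\<alpha> $ i \<noteq> 0" using assms(2) by (auto simp: vec_eq_iff)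
  \<comment> \<open>Contraction of the base block with the vector dual to \<open>\<alpha>\<close> kills the left-hand side.\<close>
  have "0 = w * \<alpha> $ i * (\<Sum>j\<in>UNIV. \<epsilon> j * (\<alpha> $ j)\<^sup>2)" by (simp add: null)
  also have "\<dots> = (\<Sum>j\<in>UNIV. w * (\<alpha> $ i * \<alpha> $ j) * (\<epsilon> j * \<alpha> $ j))"
    by (simp add: sum_distrib_left power2_eq_square mult_ac)
  also have "\<dots> = (\<Sum>j\<in>UNIV. (if i = j then lam * \<epsilon> i / (\<phi> 0)\<^sup>2 else 0) * (\<epsilon> j * \<alpha> $ j))"
    by (intro sum.cong refl) (simp add: w)
  also have "\<dots> = lam * \<alpha> $ i * (\<epsilon> i * \<epsilon> i) / (\<phi> 0)\<^sup>2"
    by (simp only: sum_if_delta) (simp add: mult_ac)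
  finally have lam: "lam = 0" using i assms(7)[of 0] by (simp add: eps)
  have flat: "ricci_flat F gF"
    unfolding ricci_flat_def using equations lam by simp
  moreover have "\<mu> = 0" if "einstein_with F gF \<mu>" for \<mu>
  proof (rule ccontr)
    assume "\<mu> \<noteq> 0"
    moreover have "\<mu> *\<^sub>R gF d0 q0 = 0"
      using that flat q0 unfolding einstein_with_def ricci_flat_def by metis
    ultimately have "(mat 1 :: real^'m^'m) = 0"
      using gF_inv[OF q0] by (auto simp: invertible_def)
    then have "(mat 1 :: real^'m^'m) $ a $ a = 0" for a by simp
    then show False by (simp add: mat_def)
  qed
  ultimately show ?thesis using lam by blast
qed

end
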